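(* Let $H=\{h_0=\mathrm{id}_H,h_1,\dots,h_{e-1}\}$ be a finite group, let $\varepsilon: H\to\{1,-1\}$ be a group homomorphism, and let $\boldsymbol{\lambda}=(\lambda_0,\ldots,\lambda_{e-1})$ be a sequence of non-negative integers. Suppose that, for infinitely many primes $p$, any subset of type $\boldsymbol{\lambda}$ of $(\mathbb{Z}_p\rtimes_{\varepsilon} H)\setminus\{\mathrm{id}\}$ is sequenceable. Then any subset of type $\boldsymbol{\lambda}$ of $(\mathbb{Z}_m\rtimes_{\varepsilon} H)\setminus\{\mathrm{id}\}$ is also sequenceable, provided that the prime factors of $m$ are all greater than $k!$, where $k=\lambda_0+\lambda_1+\dots+\lambda_{e-1}$.
   Context: For an abelian group $(A,+)$ and a homomorphism $\varepsilon:H\to\{1,-1\}$, $A\rtimes_\varepsilon H$ denotes the semidirect product with underlying set $A\times H$ and product $(x,a)(y,b)=(x+\varepsilon(a)y,\,ab)$. (This encodes the paper's property $( * )$ that each $h\in H$ acts on $A$ either as the identity or as $x\mapsto -x$, together with its convention that the same symbol denotes the corresponding action on different abelian groups.) The type of a finite subset $S$ of $A\rtimes_\varepsilon H$ is the sequence $(\lambda_0,\dots,\lambda_{e-1})$, where $\lambda_i$ is the number of elements of $S$ whose second coordinate is $h_i$. For a group $G$ and a finite subset $S\subseteq G\setminus\{\mathrm{id}_G\}$ with $|S|=k$, the partial sums of an ordering $x_1,\dots,x_k$ of the elements of $S$ (each used exactly once) are $s_0=\mathrm{id}_G$ and $s_j=x_1x_2\cdots x_j$ for $0<j\le k$. The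 ordering is a linear sequencing if $s_0,\dots,s_k$ are all different, and a cyclic sequencing if they are all different with the single exception $s_0=s_k=\mathrm{id}_G$. $S$ is sequenceable if it has a linear or a cyclic sequencing. *)

theory Defs
  imports "HOL-Algebra.Elementary_Groups" "HOL-Algebra.Sym_Groups" "HOL-Computational_Algebra.Primes"
begin

text \<open>
  The semidirect product of an abelian group \<open>A\<close> by \<open>H\<close>, where \<open>\<epsilon>\<close> maps \<open>H\<close> into
  \<open>{-1, 1}\<close>. \<open>A\<close> is written multiplicatively here, so that the action of \<open>a \<in> H\<close>
  on \<open>A\<close>, additively \<open>y \<mapsto> \<epsilon>(a) y\<close>, is the integer power with exponent \<open>\<epsilon> a\<close>.
\<close>

definition semidirect_sign ::
    "('a, 'm) monoid_scheme \<Rightarrow> ('h \<Rightarrow> int) \<Rightarrow> ('h, 'n) monoid_scheme \<Rightarrow> ('a \<times> 'h) monoid" where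
  "semidirect_sign A \<epsilon> H =
     \<lparr> carrier = carrier A \<times> carrier H,
       monoid.mult = (\<lambda>(x, a) (y, b). (x \<otimes>\<^bsub>A\<^esub> (y [^]\<^bsub>A\<^esub> \<epsilon> a), a \<otimes>\<^bsub>H\<^esub> b)),
       one = (\<one>\<^bsub>A\<^esub>, \<one>\<^bsub>H\<^esub>) \<rparr>"

lemma group_semidirect_sign:
  assumes A: "comm_group A" and H: "group H" and e: "\<epsilon> \<in> hom H sign_img"
  shows "group (semidirect_sign A \<epsilon> H)"
proof -
  interpret A: comm_group A by fact
  interpret H: group H by fact
  have sgn: "\<epsilon> a \<in> {-1, 1}" if "a \<in> carrier H" for a
    using e that by (auto simp: hom_def sign_img_def)
  have mult: "\<epsilon> (a \<otimes>\<^bsub>H\<^esub> b) = \<epsilon> a * \<epsilon> b" if "a \<in> carrier H" "b \<in> carrier H" for a b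
    using e that by (auto simp: hom_def sign_img_def)
  have one: "\<epsilon> \<one>\<^bsub>H\<^esub> = 1"
    using sgn[of "\<one>\<^bsub>H\<^esub>"] mult[of "\<one>\<^bsub>H\<^esub>" "\<one>\<^bsub>H\<^esub>"] by auto
  have sq: "\<epsilon> a * \<epsilon> a = 1" if "a \<in> carrier H" for a
    using sgn[OF that] by auto
  have inv: "\<epsilon> (inv\<^bsub>H\<^esub> a) = \<epsilon> a" if "a \<in> carrier H" for a
    using mult[of "inv\<^bsub>H\<^esub> a" a] sgn[of a] sgn[of "inv\<^bsub>H\<^esub> a"] that one by auto
  show ?thesis
  proof (rule groupI)
    fix x assume x: "x \<in> carrier (semidirect_sign A \<epsilon> H)"
    obtain y a where xy: "x = (y, a)" "y \<in> carrier A" "a \<in> carrier H"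
      using x by (auto simp: semidirect_sign_def)
    have "((inv\<^bsub>A\<^esub> y) [^]\<^bsub>A\<^esub> \<epsilon> a, inv\<^bsub>H\<^esub> a) \<otimes>\<^bsub>semidirect_sign A \<epsilon> H\<^esub> x = \<one>\<^bsub>semidirect_sign A \<epsilon> H\<^esub>"
      using xy by (simp add: semidirect_sign_def inv A.int_pow_inv)
    then show "\<exists>y\<in>carrier (semidirect_sign A \<epsilon> H).
        y \<otimes>\<^bsub>semidirect_sign A \<epsilon> H\<^esub> x = \<one>\<^bsub>semidirect_sign A \<epsilon> H\<^esub>"
      using xy by (intro bexI[of _ "((inv\<^bsub>A\<^esub> y) [^]\<^bsub>A\<^esub> \<epsilon> a, inv\<^bsub>H\<^esub> a)"])
        (simp_all add: semidirect_sign_def)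
  qed (auto simp: semidirect_sign_def one mult A.int_pow_distrib A.int_pow_pow
        A.m_assoc H.m_assoc mult.commute)
qed

lemma mult_semidirect_sign_integer_mod_group:
  "(x, a) \<otimes>\<^bsub>semidirect_sign (integer_mod_group n) \<epsilon> H\<^esub> (y, b)
     = ((x + \<epsilon> a * y) mod int n, a \<otimes>\<^bsub>H\<^esub> b)"
  by (simp add: semidirect_sign_def int_pow_integer_mod_group mod_simps)

definition subset_type :: "'h list \<Rightarrow> ('a \<times> 'h) set \<Rightarrow> nat list" where
  "subset_type hs S = map (\<lambda>h. card {x \<in> S. snd x = h}) hs"

definition partial_prod :: "('a, 'm) monoid_scheme \<Rightarrow> 'a list \<Rightarrow> nat \<Rightarrow> 'a" where
  "partial_prod G xs j = foldl (monoid.mult G) \<one>\<^bsub>G\<^esub> (take j xs)"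

definition linear_sequencing :: "('a, 'm) monoid_scheme \<Rightarrow> 'a list \<Rightarrow> bool" where
  "linear_sequencing G xs \<longleftrightarrow> inj_on (partial_prod G xs) {0..length xs}"

definition cyclic_sequencing :: "('a, 'm) monoid_scheme \<Rightarrow> 'a list \<Rightarrow> bool" where
  "cyclic_sequencing G xs \<longleftrightarrow>
     inj_on (partial_prod G xs) {0..<length xs} \<and> partial_prod G xs (length xs) = \<one>\<^bsub>G\<^esub>"

definition sequenceable :: "('a, 'm) monoid_scheme \<Rightarrow> 'a set \<Rightarrow> bool" where
  "sequenceable G S \<longleftrightarrow>
     (\<exists>xs. distinct xs \<and> set xs = S \<and> (linear_sequencing G xs \<or> cyclic_sequencing G xs))"

end

theory Submission
  imports Defs "Jordan_Normal_Form.Determinant"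
begin

text \<open>
  In a product of elements \<open>(x\<^sub>i, a\<^sub>i)\<close> of the semidirect product, the first coordinate is a
  sum of terms \<open>\<plusminus>x\<^sub>i\<close> whose signs depend on the \<open>a\<^sub>i\<close> and the ordering alone. Hence two partial
  products of an ordering coincide precisely when their \<open>H\<close>-coordinates agree, which does not
  involve the \<open>x\<^sub>i\<close>, and a linear form with coefficients in \<open>{-1, 0, 1}\<close> vanishes at \<open>x\<close>.

  It is therefore enough to replace \<open>x\<close>, which lives modulo \<open>m\<close>, by an integer vector \<open>y\<close> that
  satisfies over the integers every such relation that \<open>x\<close> satisfies modulo \<open>m\<close>, and still does not
  satisfy the finitely many relations \<open>y\<^sub>i = y\<^sub>j\<close> and \<open>y\<^sub>i = 0\<close> that fail for \<open>x\<close>. Modulo a large prime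
  \<open>p\<close> the latter relations still fail, so \<open>y\<close> defines a subset of the group over \<open>p\<close> with the same type as
  \<open>S\<close> and without the identity. An ordering that sequences this subset also sequences \<open>S\<close>
  (\<open>sequencing_transfer\<close>): a collision modulo \<open>m\<close> would force the same collision modulo \<open>p\<close>.
  At most a cyclic sequencing turns into a linear one.

  The vector \<open>y\<close> (\<open>separating_solution\<close>) comes from Cramer's rule. Among the relations that hold
  modulo \<open>m\<close>, choose a nonzero minor \<open>D\<close> of maximal size. Bordering it by one more row \<open>f\<close> and one
  more column \<open>c\<close> gives a determinant that is linear in \<open>f\<close>, so it is evaluation of \<open>f\<close> at a fixed
  integer vector; by maximality that vector solves all the relations. If all bordered minors of \<open>f\<close> vanish,
  then \<open>D f\<close> is an integer combination of the relations, so \<open>m\<close> divides \<open>D (f \<cdot> x)\<close>. The Leibniz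
  formula gives \<open>\<bar>D\<bar> \<le> k!\<close>, so \<open>D\<close> is prime to \<open>m\<close> and \<open>f\<close> was itself a relation modulo \<open>m\<close>. Here the
  hypothesis on the prime factors of \<open>m\<close> enters.
\<close>

section \<open>Integer relations with small coefficients\<close>

text \<open>
  Variables are indexed by an arbitrary set, so a linear form is its coefficient function; \<open>R\<close> lists the
  forms that serve as rows and \<open>C\<close> the variables that serve as columns.
\<close>

definition minor_mat :: "nat \<Rightarrow> (nat \<Rightarrow> 'i \<Rightarrow> int) \<Rightarrow> (nat \<Rightarrow> 'i) \<Rightarrow> int mat" where
  "minor_mat r R C = mat r r (\<lambda>(i, j). R i (C j))"

lemma minor_mat_carrier [simp]: "minor_mat r R C \<in> carrier_mat r r"
  by (simp add: minor_mat_def)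

lemma minor_mat_index [simp]: "i < r \<Longrightarrow> j < r \<Longrightarrow> minor_mat r R C $$ (i, j) = R i (C j)"
  by (simp add: minor_mat_def)

lemma abs_det_minor_mat_le_fact:
  assumes "\<And>i j. i < r \<Longrightarrow> j < r \<Longrightarrow> \<bar>R i (C j)\<bar> \<le> 1"
  shows "\<bar>det (minor_mat r R C)\<bar> \<le> fact r"
proof -
  have "\<bar>det (minor_mat r R C)\<bar>
      \<le> (\<Sum>p | p permutes {0..<r}. \<bar>signof p * (\<Prod>i = 0..<r. minor_mat r R C $$ (i, p i))\<bar>)"
    by (subst det_def'[OF minor_mat_carrier]) (rule sum_abs)
  also have "\<dots> \<le> (\<Sum>p | p permutes {0..<r}. 1)"
  proof (rule sum_mono)
    fix p assume "p \<in> {p. p permutes {0..<r}}"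
    then have p: "p i < r" if "i < r" for i
      using that permutes_in_image[of p "{0..<r}" i] by auto
    have "\<bar>\<Prod>i = 0..<r. minor_mat r R C $$ (i, p i)\<bar> \<le> (1::int)"
      unfolding abs_prod
      by (rule prod_le_1) (use p assms in \<open>auto simp: minor_mat_def\<close>)
    then show "\<bar>signof p * (\<Prod>i = 0..<r. minor_mat r R C $$ (i, p i))\<bar> \<le> (1::int)"
      by (simp add: abs_mult sign_def)
  qed
  also have "\<dots> = fact r"
    by (simp add: card_permutations)
  finally show ?thesis .
qed

lemma inj_on_columns_of_det_minor_mat:
  assumes "det (minor_mat r R C) \<noteq> 0"
  shows "inj_on C {..<r}"
proof (rule inj_onI, rule ccontr)
  fix i j assume ij: "i \<in> {..<r}" "j \<in> {..<r}" "C i = C j" "i \<noteq> j"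
  have "col (minor_mat r R C) i = col (minor_mat r R C) j"
    using ij by (auto simp: minor_mat_def)
  then have "det (minor_mat r R C) = 0"
    using ij by (intro det_identical_columns[OF minor_mat_carrier ij(4)]) auto
  with assms show False by simp
qed

definition bordered_minor :: "nat \<Rightarrow> (nat \<Rightarrow> 'i \<Rightarrow> int) \<Rightarrow> (nat \<Rightarrow> 'i) \<Rightarrow> ('i \<Rightarrow> int) \<Rightarrow> 'i \<Rightarrow> int" where
  "bordered_minor r R C f c = det (minor_mat (Suc r) (R(r := f)) (C(r := c)))"

text \<open>
  Laplace expansion along the new row: its cofactors do not involve \<open>f\<close>, so they form the vector at
  which \<open>f\<close> is evaluated.
\<close>

lemma bordered_minor_expand_row:
  assumes "finite I" "C ` {..<r} \<subseteq> I" "c \<in> I"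
  obtains y where "\<And>f. bordered_minor r R C f c = (\<Sum>v\<in>I. f v * y v)"
proof -
  define C' where "C' = C(r := c)"
  define q where "q j = cofactor (minor_mat (Suc r) R C') r j" for j
  have "bordered_minor r R C f c
      = (\<Sum>v\<in>I. f v * (\<Sum>j<Suc r. if C' j = v then q j else 0))" for f
  proof -
    have cof: "cofactor (minor_mat (Suc r) (R(r := f)) C') r j = q j" if "j < Suc r" for j
      using that by (auto simp: q_def cofactor_def mat_delete_def minor_mat_def
        intro!: arg_cong[of _ _ det])
    have "bordered_minor r R C f c
        = (\<Sum>j<Suc r. minor_mat (Suc r) (R(r := f)) C' $$ (r, j)
            * cofactor (minor_mat (Suc r) (R(r := f)) C') r j)"
      unfolding bordered_minor_def C'_def by (rule laplace_expansion_row) auto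
    also have "\<dots> = (\<Sum>j<Suc r. f (C' j) * q j)"
      by (intro sum.cong) (simp_all add: cof)
    also have "\<dots> = (\<Sum>j<Suc r. \<Sum>v\<in>I. if C' j = v then f v * q j else 0)"
    proof (rule sum.cong[OF refl])
      fix j assume "j \<in> {..<Suc r}"
      then have "C' j \<in> I" using assms by (auto simp: C'_def)
      then show "f (C' j) * q j = (\<Sum>v\<in>I. if C' j = v then f v * q j else 0)"
        using assms(1) by simp
    qed
    also have "\<dots> = (\<Sum>v\<in>I. \<Sum>j<Suc r. if C' j = v then f v * q j else 0)"
      by (rule sum.swap)
    also have "\<dots> = (\<Sum>v\<in>I. f v * (\<Sum>j<Suc r. if C' j = v then q j else 0))"
      by (simp only: sum_distrib_left if_distrib mult_zero_right)
    finally show ?thesis .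
  qed
  then show thesis by (rule that)
qed

text \<open>
  Laplace expansion along the new column: its cofactors do not involve \<open>c\<close>. When the left-hand side
  vanishes for all \<open>c\<close>, this exhibits a multiple of \<open>f\<close> as a combination of the rows.
\<close>

lemma bordered_minor_expand_column:
  obtains q where "\<And>c. bordered_minor r R C f c
    = (\<Sum>i<r. q i * R i c) + det (minor_mat r R C) * f c"
proof -
  define R' where "R' = R(r := f)"
  define q where "q i = cofactor (minor_mat (Suc r) R' C) i r" for i
  have "bordered_minor r R C f c = (\<Sum>i<r. q i * R i c) + det (minor_mat r R C) * f c" for c
  proof -
    have cof: "cofactor (minor_mat (Suc r) R' (C(r := c))) i r = q i" if "i < Suc r" for i
      using that by (auto simp: q_def cofactor_def mat_delete_def minor_mat_def
        intro!: arg_cong[of _ _ det])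
    have qr: "q r = det (minor_mat r R C)"
      by (auto simp: q_def R'_def cofactor_def mat_delete_def minor_mat_def
        intro!: arg_cong[of _ _ det])
    have "bordered_minor r R C f c
        = (\<Sum>i<Suc r. minor_mat (Suc r) R' (C(r := c)) $$ (i, r)
            * cofactor (minor_mat (Suc r) R' (C(r := c))) i r)"
      unfolding bordered_minor_def R'_def by (rule laplace_expansion_column) auto
    also have "\<dots> = (\<Sum>i<Suc r. R' i c * q i)"
      by (intro sum.cong) (simp_all add: cof)
    also have "\<dots> = (\<Sum>i<r. q i * R i c) + det (minor_mat r R C) * f c"
      by (simp add: R'_def qr mult.commute)
    finally show ?thesis .
  qed
  then show thesis by (rule that)
qed

definition small_relations :: "'i set \<Rightarrow> int \<Rightarrow> ('i \<Rightarrow> int) \<Rightarrow> ('i \<Rightarrow> int) set" where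
  "small_relations I m x =
     {w. (\<forall>i\<in>I. \<bar>w i\<bar> \<le> 1) \<and> m dvd (\<Sum>i\<in>I. w i * x i)}"

lemma coprime_if_abs_le_fact:
  fixes D :: int
  assumes "D \<noteq> 0" "\<bar>D\<bar> \<le> fact k" "\<And>q :: nat. prime q \<Longrightarrow> q dvd m \<Longrightarrow> q > fact k"
  shows "coprime (int m) D"
proof (rule ccontr)
  assume "\<not> coprime (int m) D"
  then have "\<not> coprime m (nat \<bar>D\<bar>)"
    by (metis coprime_int_iff coprime_abs_right_iff nat_0_le abs_ge_zero)
  then have "gcd m (nat \<bar>D\<bar>) \<noteq> 1"
    by (simp add: coprime_iff_gcd_eq_1)
  then obtain q where q: "prime q" "q dvd gcd m (nat \<bar>D\<bar>)"
    using prime_factor_nat by blast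
  then have "q dvd m" "q dvd nat \<bar>D\<bar>"
    using dvd_trans gcd_dvd1 gcd_dvd2 by blast+
  then have "q > fact k" "q \<le> nat \<bar>D\<bar>"
    using assms(3)[OF q(1)] \<open>D \<noteq> 0\<close> by (auto intro: dvd_imp_le)
  moreover have "nat \<bar>D\<bar> \<le> fact k"
    using assms(2) by (simp add: nat_le_iff)
  ultimately show False by simp
qed

text \<open>
  The maximal nonzero minor \<open>D\<close> has size at most \<open>card I\<close> because its columns are distinct, whence
  \<open>\<bar>D\<bar> \<le> fact (card I)\<close>. Some bordered minor of \<open>f\<close> is nonzero, since otherwise \<open>m\<close> would divide
  \<open>D (f \<cdot> x)\<close>; the row expansion of that bordered minor supplies \<open>y\<close>.
\<close>

lemma separating_solution_single:
  fixes x f :: "'i \<Rightarrow> int" and m :: nat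
  assumes I: "finite I"
    and primes: "\<And>q :: nat. prime q \<Longrightarrow> q dvd m \<Longrightarrow> q > fact (card I)"
    and f: "\<not> int m dvd (\<Sum>i\<in>I. f i * x i)"
  obtains y where "\<And>w. w \<in> small_relations I (int m) x \<Longrightarrow> (\<Sum>i\<in>I. w i * y i) = 0"
    and "(\<Sum>i\<in>I. f i * y i) \<noteq> 0"
proof -
  let ?W = "small_relations I (int m) x"
  define P where "P r \<longleftrightarrow> (\<exists>R C. (\<forall>i<r. R i \<in> ?W) \<and> C ` {..<r} \<subseteq> I
    \<and> det (minor_mat r R C) \<noteq> 0)" for r
  have bound: "r \<le> card I" if "P r" for r
  proof -
    from that obtain R C where RC: "C ` {..<r} \<subseteq> I" "det (minor_mat r R C) \<noteq> 0"
      by (auto simp: P_def)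
    then show ?thesis
      using card_inj_on_le[OF inj_on_columns_of_det_minor_mat[OF RC(2)] RC(1) I] by simp
  qed
  have "P 0"
    by (auto simp: P_def minor_mat_def)
  define r where "r = Greatest P"
  have "P r"
    unfolding r_def using \<open>P 0\<close> bound by (rule GreatestI_nat)
  have "\<not> P (Suc r)"
    using Greatest_le_nat[of P "Suc r" "card I"] bound by (auto simp: r_def)
  from \<open>P r\<close> obtain R C where R: "\<And>i. i < r \<Longrightarrow> R i \<in> ?W" and C: "C ` {..<r} \<subseteq> I"
    and D: "det (minor_mat r R C) \<noteq> 0"
    by (auto simp: P_def)
  let ?D = "det (minor_mat r R C)"
  have "\<bar>?D\<bar> \<le> fact r"
    using R C by (intro abs_det_minor_mat_le_fact) (auto simp: small_relations_def)
  also have "fact r \<le> (fact (card I) :: int)"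
    using bound[OF \<open>P r\<close>] by (rule fact_mono)
  finally have coprime: "coprime (int m) ?D"
    using D primes by (intro coprime_if_abs_le_fact)
  have "\<exists>c\<in>I. bordered_minor r R C f c \<noteq> 0"
  proof (rule ccontr)
    assume *: "\<not> ?thesis"
    obtain q where q: "\<And>c. bordered_minor r R C f c = (\<Sum>i<r. q i * R i c) + ?D * f c"
      using bordered_minor_expand_column[of r R C f] by blast
    have "?D * (\<Sum>c\<in>I. f c * x c) = (\<Sum>c\<in>I. (?D * f c) * x c)"
      by (simp add: sum_distrib_left mult.assoc)
    also have "\<dots> = (\<Sum>c\<in>I. - (\<Sum>i<r. q i * R i c) * x c)"
      using * q by (intro sum.cong) (auto simp: add_eq_0_iff)
    also have "\<dots> = - (\<Sum>c\<in>I. \<Sum>i<r. q i * (R i c * x c))"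
      by (simp add: sum_distrib_right sum_negf mult.assoc)
    also have "\<dots> = - (\<Sum>i<r. q i * (\<Sum>c\<in>I. R i c * x c))"
      by (subst sum.swap) (simp add: sum_distrib_left)
    also have "int m dvd \<dots>"
      unfolding dvd_minus_iff
      by (rule dvd_sum, rule dvd_mult) (use R in \<open>auto simp: small_relations_def\<close>)
    finally have "int m dvd (\<Sum>c\<in>I. f c * x c)"
      using coprime by (simp add: coprime_dvd_mult_right_iff)
    with f show False by simp
  qed
  then obtain c where c: "c \<in> I" "bordered_minor r R C f c \<noteq> 0" by blast
  obtain y where y: "\<And>g. bordered_minor r R C g c = (\<Sum>v\<in>I. g v * y v)"
    using bordered_minor_expand_row[OF I C c(1)] by blast
  show thesis
  proof
    show "(\<Sum>i\<in>I. f i * y i) \<noteq> 0" using c y by simp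
    fix w assume w: "w \<in> ?W"
    have "bordered_minor r R C w c = 0"
    proof (rule ccontr)
      assume *: "bordered_minor r R C w c \<noteq> 0"
      have "P (Suc r)"
        unfolding P_def
        by (rule exI[of _ "R(r := w)"], rule exI[of _ "C(r := c)"])
          (use * R w C c in \<open>auto simp: bordered_minor_def less_Suc_eq\<close>)
      with \<open>\<not> P (Suc r)\<close> show False by simp
    qed
    then show "(\<Sum>i\<in>I. w i * y i) = 0" using y by simp
  qed
qed

text \<open>
  One vector serves all of \<open>F\<close>, built by adding one form at a time: with \<open>y\<close> chosen for the earlier
  forms and \<open>z\<close> for the new one, every \<open>t y + z\<close> solves the relations,
  and a form \<open>g\<close> that is nonzero at \<open>y\<close> or at \<open>z\<close> vanishes at \<open>t y + z\<close> for at most one integer \<open>t\<close>.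
\<close>

lemma separating_solution:
  fixes x :: "'i \<Rightarrow> int" and m :: nat
  assumes I: "finite I"
    and primes: "\<And>q :: nat. prime q \<Longrightarrow> q dvd m \<Longrightarrow> q > fact (card I)"
    and F: "finite F" "\<And>f. f \<in> F \<Longrightarrow> \<not> int m dvd (\<Sum>i\<in>I. f i * x i)"
  shows "\<exists>y. (\<forall>w\<in>small_relations I (int m) x. (\<Sum>i\<in>I. w i * y i) = 0)
    \<and> (\<forall>f\<in>F. (\<Sum>i\<in>I. f i * y i) \<noteq> 0)"
  using F
proof (induction rule: finite_induct)
  case empty
  show ?case by (intro exI[of _ "\<lambda>_. 0"]) simp
next
  case (insert f F)
  let ?W = "small_relations I (int m) x"
  from insert obtain y where y: "\<forall>w\<in>?W. (\<Sum>i\<in>I. w i * y i) = 0"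
    "\<forall>g\<in>F. (\<Sum>i\<in>I. g i * y i) \<noteq> 0"
    by auto
  obtain z where z: "\<And>w. w \<in> ?W \<Longrightarrow> (\<Sum>i\<in>I. w i * z i) = 0" "(\<Sum>i\<in>I. f i * z i) \<noteq> 0"
    using separating_solution_single[OF I primes, of m f x] insert.prems by blast
  \<comment> \<open>\<open>B\<close> contains any integer root \<open>t\<close> of \<open>g \<cdot> (t y + z)\<close> for every \<open>g\<close> with \<open>g \<cdot> y \<noteq> 0\<close>. Only \<open>g = f\<close> can
    have \<open>g \<cdot> y = 0\<close>, and then \<open>f \<cdot> z \<noteq> 0\<close> suffices.\<close>
  define B where "B = (\<lambda>g. - (\<Sum>i\<in>I. g i * z i) div (\<Sum>i\<in>I. g i * y i)) ` insert f F"
  obtain t where t: "t \<notin> B"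
    using ex_new_if_finite[OF infinite_UNIV_int, of B] insert.hyps by (auto simp: B_def)
  have lin: "(\<Sum>i\<in>I. g i * (t * y i + z i)) = t * (\<Sum>i\<in>I. g i * y i) + (\<Sum>i\<in>I. g i * z i)"
    for g
    by (simp add: algebra_simps sum.distrib sum_distrib_left)
  have "(\<Sum>i\<in>I. g i * (t * y i + z i)) \<noteq> 0" if g: "g \<in> insert f F" for g
  proof
    assume 0: "(\<Sum>i\<in>I. g i * (t * y i + z i)) = 0"
    show False
    proof (cases "(\<Sum>i\<in>I. g i * y i) = 0")
      case True
      then show False using g y(2) z(2) 0 lin by auto
    next
      case False
      have "- (\<Sum>i\<in>I. g i * z i) = t * (\<Sum>i\<in>I. g i * y i)"
        using 0 lin[of g] by simp
      then have "t = - (\<Sum>i\<in>I. g i * z i) div (\<Sum>i\<in>I. g i * y i)"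
        using False by simp
      then show False using t g by (auto simp: B_def)
    qed
  qed
  moreover have "\<forall>w\<in>?W. (\<Sum>i\<in>I. w i * (t * y i + z i)) = 0"
    using y(1) z(1) by (simp add: lin)
  ultimately show ?case by (intro exI[of _ "\<lambda>i. t * y i + z i"] conjI ballI) auto
qed

section \<open>Partial products as signed sums\<close>

lemma partial_prod_0 [simp]: "partial_prod G xs 0 = \<one>\<^bsub>G\<^esub>"
  by (simp add: partial_prod_def)

lemma partial_prod_Suc:
  "j < length xs \<Longrightarrow> partial_prod G xs (Suc j) = partial_prod G xs j \<otimes>\<^bsub>G\<^esub> xs ! j"
  by (simp add: partial_prod_def take_Suc_conv_app_nth)

lemma partial_prod_closed:
  assumes "group G" "set xs \<subseteq> carrier G" "j \<le> length xs"
  shows "partial_prod G xs j \<in> carrier G"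
  using assms(3)
proof (induction j)
  case 0
  show ?case using assms(1) by (simp add: group.is_monoid monoid.one_closed)
next
  case (Suc j)
  then have "xs ! j \<in> carrier G" using assms(2) by auto
  with Suc show ?case
    using assms(1) by (simp add: partial_prod_Suc group.is_monoid monoid.m_closed)
qed

text \<open>
  A subset \<open>S\<close> over \<open>m\<close> and its counterpart over \<open>p\<close> are both images of the index set \<open>S\<close> under such
  maps, with \<open>y\<close> the first projection in the former case.
\<close>

definition residue_elem :: "nat \<Rightarrow> ('a \<times> 'h \<Rightarrow> int) \<Rightarrow> 'a \<times> 'h \<Rightarrow> int \<times> 'h" where
  "residue_elem n y s = (y s mod int n, snd s)"

lemma partial_prod_residue_elem:
  assumes "j \<le> length xs"
  shows "partial_prod (semidirect_sign (integer_mod_group n) \<epsilon> H) (map (residue_elem n y) xs) j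
    = ((\<Sum>t<j. \<epsilon> (partial_prod H (map snd xs) t) * y (xs ! t)) mod int n,
       partial_prod H (map snd xs) j)"
  using assms
proof (induction j)
  case 0
  show ?case by (simp add: semidirect_sign_def)
next
  case (Suc j)
  then show ?case
    by (simp add: partial_prod_Suc residue_elem_def mult_semidirect_sign_integer_mod_group)
      (intro mod_add_cong mod_mult_right_eq mod_mod_trivial refl)
qed

text \<open>
  The difference of two partial sums is a sum over a block of consecutive positions. Each element
  occurs at most once there, so the difference is a form with coefficients in \<open>{-1, 0, 1}\<close>.
\<close>

lemma signed_block_sum_as_form:
  fixes e :: "nat \<Rightarrow> int"
  assumes xs: "distinct xs" and j: "j \<le> length xs" and e: "\<And>t. t < j \<Longrightarrow> \<bar>e t\<bar> \<le> 1"
  obtains w where "\<And>s. \<bar>w s\<bar> \<le> (1 :: int)"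
    and "\<And>y. (\<Sum>t\<in>{i..<j}. e t * y (xs ! t)) = (\<Sum>s\<in>set xs. w s * y s)"
proof -
  define T where "T s = {t \<in> {i..<j}. xs ! t = s}" for s
  define w where "w s = (\<Sum>t\<in>T s. e t)" for s
  have "\<bar>w s\<bar> \<le> 1" for s
  proof -
    have "T s = {} \<or> (\<exists>t\<in>{i..<j}. T s = {t})"
      using xs j by (auto simp: T_def nth_eq_iff_index_eq)
    then show ?thesis using e by (auto simp: w_def)
  qed
  moreover have "(\<Sum>t\<in>{i..<j}. e t * y (xs ! t)) = (\<Sum>s\<in>set xs. w s * y s)" for y
  proof -
    have "(\<Sum>t\<in>{i..<j}. e t * y (xs ! t)) = (\<Sum>s\<in>set xs. \<Sum>t\<in>T s. e t * y (xs ! t))"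
      unfolding T_def using j by (intro sum.group[symmetric]) auto
    also have "\<dots> = (\<Sum>s\<in>set xs. w s * y s)"
      by (intro sum.cong) (auto simp: T_def w_def sum_distrib_right)
    finally show ?thesis .
  qed
  ultimately show thesis by (rule that)
qed

context
  fixes H :: "('h, 'n) monoid_scheme" and \<epsilon> :: "'h \<Rightarrow> int" and xs :: "('a \<times> 'h) list"
    and m p :: nat and x y :: "'a \<times> 'h \<Rightarrow> int"
  assumes H: "group H" and \<epsilon>: "\<epsilon> \<in> hom H sign_img"
    and xs: "distinct xs" and snd_xs: "snd ` set xs \<subseteq> carrier H"
    and y: "\<And>w. w \<in> small_relations (set xs) (int m) x \<Longrightarrow> (\<Sum>s\<in>set xs. w s * y s) = 0"
begin

abbreviation (input) "pp_m \<equiv>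
  partial_prod (semidirect_sign (integer_mod_group m) \<epsilon> H) (map (residue_elem m x) xs)"

abbreviation (input) "pp_p \<equiv>
  partial_prod (semidirect_sign (integer_mod_group p) \<epsilon> H) (map (residue_elem p y) xs)"

text \<open>
  A collision modulo \<open>m\<close> is a small relation satisfied by \<open>x\<close>; being satisfied by \<open>y\<close> over the integers,
  it produces a collision modulo every \<open>p\<close>.
\<close>

lemma partial_prod_collision_transfer:
  assumes ij: "i < j" "j \<le> length xs" and eq: "pp_m i = pp_m j"
  shows "pp_p i = pp_p j"
proof -
  define h where "h = partial_prod H (map snd xs)"
  define e where "e t = \<epsilon> (h t)" for t
  have e: "\<bar>e t\<bar> \<le> 1" if "t < j" for t
  proof -
    have "h t \<in> carrier H"
      unfolding h_def using H snd_xs ij that by (intro partial_prod_closed) auto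
    then have "e t \<in> {-1, 1}"
      using \<epsilon> by (auto simp: e_def hom_def sign_img_def)
    then show ?thesis by auto
  qed
  obtain w where w: "\<And>s. \<bar>w s\<bar> \<le> (1 :: int)"
    "\<And>z. (\<Sum>t\<in>{i..<j}. e t * z (xs ! t)) = (\<Sum>s\<in>set xs. w s * z s)"
    using signed_block_sum_as_form[where e = e and i = i, OF xs ij(2) e] by blast
  have split: "(\<Sum>t<j. e t * z (xs ! t)) = (\<Sum>t<i. e t * z (xs ! t)) + (\<Sum>s\<in>set xs. w s * z s)"
    for z :: "'a \<times> 'h \<Rightarrow> int"
    unfolding w(2)[symmetric] lessThan_atLeast0 using ij
    by (intro sum.atLeastLessThan_concat[symmetric]) auto
  have pp: "partial_prod (semidirect_sign (integer_mod_group n) \<epsilon> H) (map (residue_elem n z) xs) l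
      = ((\<Sum>t<l. e t * z (xs ! t)) mod int n, h l)" if "l \<le> length xs" for n l z
    using partial_prod_residue_elem[OF that] by (simp add: e_def h_def)
  from eq ij have h_eq: "h i = h j"
    and "(\<Sum>t<i. e t * x (xs ! t)) mod int m = (\<Sum>t<j. e t * x (xs ! t)) mod int m"
    by (auto simp: pp)
  then have "int m dvd (\<Sum>s\<in>set xs. w s * x s)"
    by (auto simp: split mod_eq_dvd_iff)
  then have "(\<Sum>s\<in>set xs. w s * y s) = 0"
    using w(1) by (intro y) (auto simp: small_relations_def)
  then show ?thesis
    using ij h_eq by (simp add: pp split)
qed

text \<open>
  If the ordering is not linear modulo \<open>m\<close>, its collision occurs modulo \<open>p\<close> too. There a sequencing
  allows only the collision of the first with the last partial product, so modulo \<open>m\<close> this is also the only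
  one and the sequencing is cyclic.
\<close>

lemma sequencing_transfer:
  assumes seq: "linear_sequencing (semidirect_sign (integer_mod_group p) \<epsilon> H) (map (residue_elem p y) xs)
    \<or> cyclic_sequencing (semidirect_sign (integer_mod_group p) \<epsilon> H) (map (residue_elem p y) xs)"
  shows "linear_sequencing (semidirect_sign (integer_mod_group m) \<epsilon> H) (map (residue_elem m x) xs)
    \<or> cyclic_sequencing (semidirect_sign (integer_mod_group m) \<epsilon> H) (map (residue_elem m x) xs)"
proof (cases "inj_on pp_m {0..length xs}")
  case True
  then show ?thesis by (simp add: linear_sequencing_def)
next
  case False
  then obtain i j where ij: "i < j" "j \<le> length xs" "pp_m i = pp_m j"
    unfolding inj_on_def by (metis atLeastAtMost_iff linorder_neqE_nat)
  have coll: "pp_p i = pp_p j"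
    using ij by (rule partial_prod_collision_transfer)
  then have "\<not> inj_on pp_p {0..length xs}"
    using ij by (auto dest: inj_onD)
  then have inj: "inj_on pp_p {0..<length xs}" and closed: "pp_p (length xs) = pp_p 0"
    using seq by (auto simp: linear_sequencing_def cyclic_sequencing_def)
  have "j = length xs"
    using inj_onD[OF inj coll] ij by (cases "j = length xs") auto
  moreover have "i = 0"
    using inj_onD[OF inj, of i 0] coll closed ij \<open>j = length xs\<close> by (cases "xs = []") auto
  ultimately have "pp_m (length xs) = pp_m 0"
    using ij by simp
  moreover have "inj_on pp_m {0..<length xs}"
  proof (rule inj_onI, rule ccontr)
    fix a b assume ab: "a \<in> {0..<length xs}" "b \<in> {0..<length xs}" "pp_m a = pp_m b" "a \<noteq> b"
    then have "pp_p a = pp_p b"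
      using partial_prod_collision_transfer[of a b] partial_prod_collision_transfer[of b a]
      by (cases "a < b") auto
    with ab inj show False by (auto dest: inj_onD)
  qed
  ultimately show ?thesis by (simp add: cyclic_sequencing_def)
qed

end

section \<open>From large primes to arbitrary moduli\<close>

lemma sum_list_subset_type:
  assumes "finite S" "distinct hs" "snd ` S \<subseteq> set hs"
  shows "sum_list (subset_type hs S) = card S"
proof -
  have "sum_list (subset_type hs S) = (\<Sum>h\<in>set hs. \<Sum>s\<in>{s \<in> S. snd s = h}. 1)"
    using assms by (simp add: subset_type_def sum_list_distinct_conv_sum_set)
  also have "\<dots> = card S"
    using assms by (subst sum.group) auto
  finally show ?thesis .
qed

lemma subset_type_residue_elem:
  assumes "inj_on (residue_elem p y) S"
  shows "subset_type hs (residue_elem p y ` S) = subset_type hs S"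
proof -
  have "card {s \<in> residue_elem p y ` S. snd s = h} = card {s \<in> S. snd s = h}" for h
  proof -
    have "{s \<in> residue_elem p y ` S. snd s = h} = residue_elem p y ` {s \<in> S. snd s = h}"
      by (auto simp: residue_elem_def)
    then show ?thesis
      using inj_on_subset[OF assms] by (simp add: card_image)
  qed
  then show ?thesis by (simp add: subset_type_def)
qed

lemma carrier_semidirect_sign_integer_mod_group:
  "n > 0 \<Longrightarrow> carrier (semidirect_sign (integer_mod_group n) \<epsilon> H) = {0..<int n} \<times> carrier H"
  by (simp add: semidirect_sign_def carrier_integer_mod_group)

lemma one_semidirect_sign_integer_mod_group:
  "\<one>\<^bsub>semidirect_sign (integer_mod_group n) \<epsilon> H\<^esub> = (0, \<one>\<^bsub>H\<^esub>)"
  by (simp add: semidirect_sign_def)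

theorem theorem3p14:
  fixes H :: "('h, 'n) monoid_scheme"
    and hs :: "'h list"
    and \<epsilon> :: "'h \<Rightarrow> int"
    and lam :: "nat list"
    and k m :: nat
  assumes "group H"
    and "finite (carrier H)"
    and "distinct hs" and "set hs = carrier H" and "hs ! 0 = \<one>\<^bsub>H\<^esub>"
    and "\<epsilon> \<in> hom H sign_img"
    and "length lam = length hs"
    and "k = sum_list lam"
    and "infinite {p :: nat. prime p \<and>
           (\<forall>S. S \<subseteq> carrier (semidirect_sign (integer_mod_group p) \<epsilon> H)
                    - {\<one>\<^bsub>semidirect_sign (integer_mod_group p) \<epsilon> H\<^esub>}
              \<and> subset_type hs S = lam
              \<longrightarrow> sequenceable (semidirect_sign (integer_mod_group p) \<epsilon> H) S)}"
    and "m > 0"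
    and "\<forall>q :: nat. prime q \<and> q dvd m \<longrightarrow> q > fact k"
  shows "\<forall>S. S \<subseteq> carrier (semidirect_sign (integer_mod_group m) \<epsilon> H)
                    - {\<one>\<^bsub>semidirect_sign (integer_mod_group m) \<epsilon> H\<^esub>}
              \<and> subset_type hs S = lam
              \<longrightarrow> sequenceable (semidirect_sign (integer_mod_group m) \<epsilon> H) S"
proof (intro allI impI, elim conjE)
  fix S
  assume S: "S \<subseteq> carrier (semidirect_sign (integer_mod_group m) \<epsilon> H)
      - {\<one>\<^bsub>semidirect_sign (integer_mod_group m) \<epsilon> H\<^esub>}"
    and type: "subset_type hs S = lam"
  have S': "S \<subseteq> {0..<int m} \<times> carrier H - {(0, \<one>\<^bsub>H\<^esub>)}"
    using S \<open>m > 0\<close>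
    by (simp only: carrier_semidirect_sign_integer_mod_group one_semidirect_sign_integer_mod_group)
  have fst_S: "0 \<le> fst s \<and> fst s < int m" and snd_S: "snd s \<in> carrier H"
    and nontriv: "snd s = \<one>\<^bsub>H\<^esub> \<longrightarrow> fst s \<noteq> 0" if "s \<in> S" for s
    using subsetD[OF S' that] by (cases s; auto; fail)+
  have "finite S"
    using S' \<open>finite (carrier H)\<close> by (auto intro: finite_subset)
  have snd_hs: "snd ` S \<subseteq> set hs"
    using snd_S \<open>set hs = carrier H\<close> by (intro image_subsetI) simp
  then have "card S = k"
    using sum_list_subset_type[OF \<open>finite S\<close> \<open>distinct hs\<close>] type \<open>k = sum_list lam\<close> by simp
  have primes: "q > fact (card S)" if "prime q" "q dvd m" for q :: nat
    using assms(11) that \<open>card S = k\<close> by simp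
  \<comment> \<open>Nonvanishing of the forms in \<open>F\<close> at \<open>y\<close> modulo \<open>p\<close> is what keeps the image of \<open>S\<close> in the
    \<open>p\<close>-group free of coincidences and of the identity. Only pairs with the same \<open>H\<close>-coordinate
    can collide.\<close>
  define F where "F = (\<Union>s\<in>S. (\<lambda>s' v. of_bool (v = s) - of_bool (v = s') :: int)
        ` {s' \<in> S. s \<noteq> s' \<and> snd s = snd s'})
      \<union> (\<lambda>s v. of_bool (v = s)) ` {s \<in> S. snd s = \<one>\<^bsub>H\<^esub>}"
  have form1: "(\<Sum>v\<in>S. of_bool (v = s) * z v) = z s" if "s \<in> S" for s and z :: "_ \<Rightarrow> int"
    using that \<open>finite S\<close> by (simp add: of_bool_def if_distrib[of "\<lambda>a. a * _"] cong: if_cong)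
  have form2: "(\<Sum>v\<in>S. (of_bool (v = s) - of_bool (v = s')) * z v) = z s - z s'"
    if "s \<in> S" "s' \<in> S" for s s' and z :: "_ \<Rightarrow> int"
    using that by (simp add: left_diff_distrib sum_subtractf form1)
  have "finite F"
    unfolding F_def using \<open>finite S\<close> by simp
  have F: "\<not> int m dvd (\<Sum>v\<in>S. f v * fst v)" if f: "f \<in> F" for f
  proof -
    have pair: "\<not> int m dvd fst s - fst s'"
      if "s \<in> S" "s' \<in> S" "s \<noteq> s'" "snd s = snd s'" for s s'
    proof
      assume "int m dvd fst s - fst s'"
      then have "fst s mod int m = fst s' mod int m" by (simp add: mod_eq_dvd_iff)
      then have "fst s = fst s'" using fst_S that by simp
      with that show False by (simp add: prod_eq_iff)
    qed
    have single: "\<not> int m dvd fst s" if "s \<in> S" "snd s = \<one>\<^bsub>H\<^esub>" for s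
      using fst_S nontriv that zdvd_not_zless[of "fst s" "int m"]
      by (metis order_le_less)
    consider s s' where "s \<in> S" "s' \<in> S" "s \<noteq> s'" "snd s = snd s'"
        "f = (\<lambda>v. of_bool (v = s) - of_bool (v = s'))"
      | s where "s \<in> S" "snd s = \<one>\<^bsub>H\<^esub>" "f = (\<lambda>v. of_bool (v = s))"
      using f unfolding F_def by blast
    then show ?thesis
      by cases (use pair single in \<open>simp_all add: form1 form2\<close>)
  qed
  have "\<exists>y. (\<forall>w\<in>small_relations S (int m) fst. (\<Sum>v\<in>S. w v * y v) = 0)
      \<and> (\<forall>f\<in>F. (\<Sum>v\<in>S. f v * y v) \<noteq> 0)"
    by (rule separating_solution) (use \<open>finite S\<close> primes \<open>finite F\<close> F in auto)
  then obtain y where y: "\<forall>w\<in>small_relations S (int m) fst. (\<Sum>v\<in>S. w v * y v) = 0"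
    and yF: "\<forall>f\<in>F. (\<Sum>v\<in>S. f v * y v) \<noteq> 0"
    by blast
  \<comment> \<open>Any prime above \<open>N\<close> is larger than every nonzero integer \<open>\<bar>f \<cdot> y\<bar>\<close> with \<open>f \<in> F\<close>,
    so it divides none of them.\<close>
  define N where "N = (\<Sum>f\<in>F. nat \<bar>\<Sum>v\<in>S. f v * y v\<bar>)"
  define P where "P = {p :: nat. prime p \<and>
      (\<forall>S. S \<subseteq> carrier (semidirect_sign (integer_mod_group p) \<epsilon> H)
            - {\<one>\<^bsub>semidirect_sign (integer_mod_group p) \<epsilon> H\<^esub>}
          \<and> subset_type hs S = lam
        \<longrightarrow> sequenceable (semidirect_sign (integer_mod_group p) \<epsilon> H) S)}"
  have "infinite P"
    unfolding P_def by (rule assms(9))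
  then obtain p where "p > N" "p \<in> P"
    unfolding infinite_nat_iff_unbounded by blast
  then have "prime p"
    and p: "S' \<subseteq> carrier (semidirect_sign (integer_mod_group p) \<epsilon> H)
          - {\<one>\<^bsub>semidirect_sign (integer_mod_group p) \<epsilon> H\<^esub>} \<Longrightarrow> subset_type hs S' = lam
        \<Longrightarrow> sequenceable (semidirect_sign (integer_mod_group p) \<epsilon> H) S'" for S'
    unfolding P_def by blast+
  have "p > 0" using \<open>prime p\<close> by (simp add: prime_gt_0_nat)
  have p_ndvd: "\<not> int p dvd (\<Sum>v\<in>S. f v * y v)" if "f \<in> F" for f
  proof
    assume "int p dvd (\<Sum>v\<in>S. f v * y v)"
    then have "int p \<le> \<bar>\<Sum>v\<in>S. f v * y v\<bar>"
      using yF that dvd_imp_le_int[of "\<Sum>v\<in>S. f v * y v" "int p"] by simp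
    moreover have "nat \<bar>\<Sum>v\<in>S. f v * y v\<bar> \<le> N"
      unfolding N_def using that \<open>finite F\<close>
      by (intro member_le_sum[of f F "\<lambda>f. nat \<bar>\<Sum>v\<in>S. f v * y v\<bar>"]) auto
    ultimately show False using \<open>p > N\<close> by linarith
  qed
  have inj: "inj_on (residue_elem p y) S"
  proof (rule inj_onI, rule ccontr)
    fix s s' assume s: "s \<in> S" "s' \<in> S" "residue_elem p y s = residue_elem p y s'" "s \<noteq> s'"
    then have "(\<lambda>v. of_bool (v = s) - of_bool (v = s')) \<in> F"
      unfolding F_def residue_elem_def by blast
    from p_ndvd[OF this] s show False
      by (simp add: form2 residue_elem_def mod_eq_dvd_iff)
  qed
  have "residue_elem p y ` S \<subseteq> carrier (semidirect_sign (integer_mod_group p) \<epsilon> H)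
      - {\<one>\<^bsub>semidirect_sign (integer_mod_group p) \<epsilon> H\<^esub>}"
  proof (intro image_subsetI)
    fix s assume s: "s \<in> S"
    have "residue_elem p y s \<noteq> (0, \<one>\<^bsub>H\<^esub>)"
    proof
      assume eq: "residue_elem p y s = (0, \<one>\<^bsub>H\<^esub>)"
      then have "(\<lambda>v. of_bool (v = s)) \<in> F"
        using s unfolding F_def residue_elem_def by blast
      from p_ndvd[OF this] s eq show False
        by (simp add: form1 residue_elem_def dvd_eq_mod_eq_0)
    qed
    then show "residue_elem p y s \<in> carrier (semidirect_sign (integer_mod_group p) \<epsilon> H)
      - {\<one>\<^bsub>semidirect_sign (integer_mod_group p) \<epsilon> H\<^esub>}"
      using snd_S[OF s] \<open>p > 0\<close>
      by (simp add: carrier_semidirect_sign_integer_mod_group one_semidirect_sign_integer_mod_group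
          residue_elem_def)
  qed
  moreover have "subset_type hs (residue_elem p y ` S) = lam"
    using subset_type_residue_elem[OF inj] type by simp
  ultimately have "sequenceable (semidirect_sign (integer_mod_group p) \<epsilon> H) (residue_elem p y ` S)"
    by (rule p)
  then obtain ys where ys: "distinct ys" "set ys = residue_elem p y ` S"
    and seq: "linear_sequencing (semidirect_sign (integer_mod_group p) \<epsilon> H) ys
      \<or> cyclic_sequencing (semidirect_sign (integer_mod_group p) \<epsilon> H) ys"
    by (auto simp: sequenceable_def)
  define xs where "xs = map (inv_into S (residue_elem p y)) ys"
  have ys_eq: "map (residue_elem p y) xs = ys"
    using ys(2) by (auto simp: xs_def f_inv_into_f intro!: map_idI)
  have "distinct xs"
    using ys ys_eq by (metis distinct_map)
  have "set xs = S"
    using ys(2) inj by (auto simp: xs_def image_image)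
  \<comment> \<open>The first coordinates of \<open>S\<close> are already reduced modulo \<open>m\<close>.\<close>
  have "map (residue_elem m fst) xs = xs"
    using fst_S \<open>set xs = S\<close> by (intro map_idI) (simp add: residue_elem_def)
  then have "linear_sequencing (semidirect_sign (integer_mod_group m) \<epsilon> H) xs
      \<or> cyclic_sequencing (semidirect_sign (integer_mod_group m) \<epsilon> H) xs"
    using sequencing_transfer[OF \<open>group H\<close> \<open>\<epsilon> \<in> hom H sign_img\<close> \<open>distinct xs\<close>, of m fst y p]
      snd_hs \<open>set hs = carrier H\<close> y seq \<open>set xs = S\<close> ys_eq by simp
  with \<open>distinct xs\<close> \<open>set xs = S\<close>
  show "sequenceable (semidirect_sign (integer_mod_group m) \<epsilon> H) S"
    by (auto simp: sequenceable_def)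
qed

end
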